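(* Let $n\ge1$, let $T$ be a non-crossing tree on the vertices $0,1,\ldots,n$, let $P$ be the associated poset on $\{1,\ldots,n\}$ and let $L(P)\subset\mathfrak{S}_n$ be its set of linear extensions. Let $I$ be the set of planar binary trees with $n$ internal nodes determined by $$\sum_{\sigma\in L(P)}\mathbf{F}_\sigma=\sum_{t\in I}\mathbf{P}_t$$ (there is such a set $I$). Then $I$ is an interval of the Tamari order.
   Context: Non-crossing trees. Consider a convex polygon with vertices $0,1,\ldots,n$ in cyclic order. The side $\{0,n\}$ is called the base; for $1\le i\le n$ the side $\{i-1,i\}$ is called side number $i$ (for $n=1$ the only possible edge is $\{0,1\}$, regarded as side number $1$). A non-crossing tree $T$ is a tree with vertex set $\{0,\ldots,n\}$ whose edges, drawn as straight segments, do not cross (two edges may meet only at a common endpoint). It has $n$ edges; the base may or may not be an edge of $T$. Labels of edges and poset. An edge $\{a,b\}$ with $a<b$ separates from the base the sides numbered $a+1,\ldots,b$, and separates from the base every other edge $\{c,d\}$ of $T$ with $a\le c<d\le b$. A side edge $\{i-1,i\}$ of $T$ is labeled $i$. Any other edge $e=\{a,b\}$ of $T$ (diagonal, or the base when it belongs to $T$) is labeled by the unique side number $i\in\{a+1,\ldots,b\}$ such that side $i$ is not an edge of $T$ and is not separated from the base by any other edge $\{c,d\}$ of $T$ with $a\le c<d\le b$ (so $e$ and side $i$ bound the same region on the side of $e$ away from the base). The edges of $T$ are thereby labeled bijectively by $\{1,\ldots,n\}$. The poset $P$ on $\{1,\ldots,n\}$ is defined by: $i<_P j$ iff the edge labeled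 $i$ is separated from the base by the edge labeled $j$. Linear extensions. $L(P)$ is the set of $\sigma\in\mathfrak{S}_n$ such that $i$ appears to the left of $j$ in the word $\sigma(1)\sigma(2)\cdots\sigma(n)$ whenever $i<_P j$. $\mathbf{FQSym}$ and $\mathbf{PBT}$. $\mathbf{FQSym}$ is the algebra of free quasi-symmetric functions, with linear basis $(\mathbf{F}_\sigma)$ indexed by all permutations. For a planar binary tree $t$ with $n$ internal nodes, $\mathbf{P}_t=\sum_\sigma\mathbf{F}_\sigma$, the sum being over all $\sigma\in\mathfrak{S}_n$ such that the decreasing tree of $\sigma^{-1}$ has shape $t$. Here the decreasing tree of a word with distinct letters $w=u\,m\,v$, where $m$ is its largest letter, has root $m$, left subtree the decreasing tree of $u$, and right subtree the decreasing tree of $v$. The $\mathbf{P}_t$ are a basis of the subalgebra $\mathbf{PBT}$ (the free dendriform algebra on one generator) of $\mathbf{FQSym}$. The Tamari order on planar binary trees with $n$ internal nodes is the partial order whose covering relations are the tree rotations (replacing a subtree $(A\wedge B)\wedge C$ by $A\wedge(B\wedge C)$, where $\wedge$ joins a left and a right subtree under a root). An interval is a set of the form $\{t: t_0\le t\le t_1\}$ with $t_0\le t_1$. *)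

theory Defs
  imports Complex_Main "HOL-Library.Tree" "HOL-Library.Poly_Mapping"
    "HOL-Combinatorics.Permutations"
begin

section \<open>Non-crossing trees\<close>

text \<open>Edges are two-element sets of vertices.\<close>

definition connected_graph :: "'v set \<Rightarrow> 'v set set \<Rightarrow> bool" where
  "connected_graph V E \<longleftrightarrow> V \<noteq> {} \<and> (\<forall>u\<in>V. \<forall>v\<in>V. (u, v) \<in> {(x, y). {x, y} \<in> E}\<^sup>*)"

definition graph_cycle :: "'v set set \<Rightarrow> 'v list \<Rightarrow> bool" where
  "graph_cycle E vs \<longleftrightarrow> 3 \<le> length vs \<and> distinct vs \<and>
     (\<forall>i<length vs. {vs ! i, vs ! (Suc i mod length vs)} \<in> E)"

definition tree_on :: "'v set \<Rightarrow> 'v set set \<Rightarrow> bool" where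
  "tree_on V E \<longleftrightarrow> (\<forall>e\<in>E. e \<subseteq> V \<and> card e = 2) \<and> connected_graph V E \<and> (\<nexists>vs. graph_cycle E vs)"

text \<open>For vertices of a convex polygon numbered in cyclic order, the segments \<open>{a, b}\<close> and
  \<open>{c, d}\<close> meet outside a common endpoint iff their endpoints interleave.\<close>

definition crossing :: "nat set \<Rightarrow> nat set \<Rightarrow> bool" where
  "crossing e f \<longleftrightarrow> (\<exists>a b c d. a < c \<and> c < b \<and> b < d \<and>
     (e = {a, b} \<and> f = {c, d} \<or> f = {a, b} \<and> e = {c, d}))"

definition noncrossing_tree :: "nat \<Rightarrow> nat set set \<Rightarrow> bool" where
  "noncrossing_tree n E \<longleftrightarrow> tree_on {0..n} E \<and> (\<forall>e\<in>E. \<forall>f\<in>E. \<not> crossing e f)"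

section \<open>Edge labels and the poset\<close>

text \<open>In what follows an edge \<open>{a, b}\<close> is given by its endpoints \<open>a < b\<close>.\<close>

definition separates_side :: "nat \<Rightarrow> nat \<Rightarrow> nat \<Rightarrow> bool" where
  "separates_side a b i \<longleftrightarrow> i \<in> {a+1..b}"

definition separates_edge :: "nat \<Rightarrow> nat \<Rightarrow> nat \<Rightarrow> nat \<Rightarrow> bool" where
  "separates_edge a b c d \<longleftrightarrow> a \<le> c \<and> c < d \<and> d \<le> b \<and> (c, d) \<noteq> (a, b)"

text \<open>The case \<open>b = a + 1\<close> is that of a side edge; it includes the edge \<open>{0, 1}\<close> for \<open>n = 1\<close>,
  which counts as side number 1.\<close>

definition edge_label :: "nat set set \<Rightarrow> nat \<Rightarrow> nat \<Rightarrow> nat" where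
  "edge_label E a b = (if b = a + 1 then b
     else (THE i. separates_side a b i \<and> {i - 1, i} \<notin> E \<and>
       (\<forall>c d. {c, d} \<in> E \<and> separates_edge a b c d \<longrightarrow> \<not> separates_side c d i)))"

text \<open>The strict order: the pair \<open>(i, j)\<close> belongs to it iff \<open>i <\<^sub>P j\<close>.\<close>

definition nct_poset :: "nat set set \<Rightarrow> (nat \<times> nat) set" where
  "nct_poset E = {(edge_label E c d, edge_label E a b) | a b c d.
     {a, b} \<in> E \<and> {c, d} \<in> E \<and> a < b \<and> separates_edge a b c d}"

section \<open>Permutations and linear extensions\<close>

text \<open>The size is part of the data, so that the elements of different symmetric groups are
  different.\<close>

typedef fin_perm = "{(n::nat, f::nat \<Rightarrow> nat). f permutes {1..n}}"
  by (rule exI[of _ "(0, id)"]) (simp add: permutes_id)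

definition perm_size :: "fin_perm \<Rightarrow> nat" where
  "perm_size \<sigma> = fst (Rep_fin_perm \<sigma>)"

definition perm_fun :: "fin_perm \<Rightarrow> nat \<Rightarrow> nat" where
  "perm_fun \<sigma> = snd (Rep_fin_perm \<sigma>)"

definition inv_word :: "fin_perm \<Rightarrow> nat list" where
  "inv_word \<sigma> = map (inv (perm_fun \<sigma>)) [1..<perm_size \<sigma> + 1]"

definition linear_extensions :: "nat \<Rightarrow> (nat \<times> nat) set \<Rightarrow> fin_perm set" where
  "linear_extensions n P = {\<sigma>. perm_size \<sigma> = n \<and>
     (\<forall>p\<in>{1..n}. \<forall>q\<in>{1..n}. (perm_fun \<sigma> p, perm_fun \<sigma> q) \<in> P \<longrightarrow> p < q)}"

section \<open>Planar binary trees and the Tamari order\<close>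

text \<open>The internal nodes of a planar binary tree are the \<open>Node\<close>s, counted by \<open>size\<close>.\<close>

type_synonym pbtree = "unit tree"

function decreasing_tree :: "'a::linorder list \<Rightarrow> 'a tree" where
  "decreasing_tree w = (if w = [] then Leaf
     else let m = Max (set w) in
       Node (decreasing_tree (takeWhile (\<lambda>x. x \<noteq> m) w)) m
            (decreasing_tree (tl (dropWhile (\<lambda>x. x \<noteq> m) w))))"
  by pat_completeness auto
termination
proof (relation "measure length")
  fix w :: "'a list" and m
  assume "w \<noteq> []" and m: "m = Max (set w)"
  then have mem: "m \<in> set w" by simp
  have "length (takeWhile (\<lambda>x. x \<noteq> m) w) < length w"
    using mem by (metis (mono_tags, lifting) length_takeWhile_le le_neq_implies_less
        set_takeWhileD takeWhile_eq_take take_all_iff order_refl)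
  then show "(takeWhile (\<lambda>x. x \<noteq> m) w, w) \<in> measure length" by simp
  have "length (tl (dropWhile (\<lambda>x. x \<noteq> m) w)) < length w"
    using \<open>w \<noteq> []\<close> length_dropWhile_le[of "\<lambda>x. x \<noteq> m" w] by (cases w) auto
  then show "(tl (dropWhile (\<lambda>x. x \<noteq> m) w), w) \<in> measure length" by simp
qed simp

declare decreasing_tree.simps [simp del]

definition tree_shape :: "'a tree \<Rightarrow> pbtree" where
  "tree_shape = map_tree (\<lambda>_. ())"

inductive rotation :: "pbtree \<Rightarrow> pbtree \<Rightarrow> bool" where
  root: "rotation (Node (Node A x B) y C) (Node A x (Node B y C))"
| left: "rotation l l' \<Longrightarrow> rotation (Node l x r) (Node l' x r)"
| right: "rotation r r' \<Longrightarrow> rotation (Node l x r) (Node l x r')"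

definition tamari_le :: "pbtree \<Rightarrow> pbtree \<Rightarrow> bool" where
  "tamari_le = rotation\<^sup>*\<^sup>*"

definition tamari_interval :: "nat \<Rightarrow> pbtree set \<Rightarrow> bool" where
  "tamari_interval n I \<longleftrightarrow> (\<exists>t\<^sub>0 t\<^sub>1. size t\<^sub>0 = n \<and> size t\<^sub>1 = n \<and> tamari_le t\<^sub>0 t\<^sub>1 \<and>
     I = {t. size t = n \<and> tamari_le t\<^sub>0 t \<and> tamari_le t t\<^sub>1})"

section \<open>Free quasi-symmetric functions\<close>

text \<open>\<open>FQSym\<close> over a field \<open>'k\<close>, as the vector space with basis \<open>(F \<sigma>)\<close>; only the linear
  structure is needed here, not the product.\<close>

type_synonym 'k fqsym = "fin_perm \<Rightarrow>\<^sub>0 'k"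

definition F_basis :: "fin_perm \<Rightarrow> 'k::field fqsym" where
  "F_basis \<sigma> = Poly_Mapping.single \<sigma> 1"

definition P_basis :: "pbtree \<Rightarrow> 'k::field fqsym" where
  "P_basis t = (\<Sum>\<sigma> | perm_size \<sigma> = size t \<and> tree_shape (decreasing_tree (inv_word \<sigma>)) = t. F_basis \<sigma>)"

text \<open>The index sets of all sums in use are finite, so none of them degenerates to 0.\<close>

lemma finite_fin_perm: "finite {\<sigma>. perm_size \<sigma> = n}"
proof (rule inj_on_finite[of perm_fun _ "{f. f permutes {1..n}}"])
  show "inj_on perm_fun {\<sigma>. perm_size \<sigma> = n}"
    by (auto simp: inj_on_def perm_fun_def perm_size_def Rep_fin_perm_inject[symmetric] prod_eq_iff)
  show "perm_fun ` {\<sigma>. perm_size \<sigma> = n} \<subseteq> {f. f permutes {1..n}}"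
  proof
    fix f
    assume "f \<in> perm_fun ` {\<sigma>. perm_size \<sigma> = n}"
    then obtain \<sigma> where "perm_size \<sigma> = n" "f = perm_fun \<sigma>" by auto
    then show "f \<in> {f. f permutes {1..n}}"
      using Rep_fin_perm[of \<sigma>] by (simp add: perm_fun_def perm_size_def case_prod_beta)
  qed
  show "finite {f. f permutes {1..n}}" by (rule finite_permutations) simp
qed

lemma finite_pbtree: "finite {t :: pbtree. size t = n}"
proof -
  have "finite {t :: pbtree. size t \<le> n}"
  proof (induction n)
    case (Suc n)
    have "{t :: pbtree. size t \<le> Suc n} \<subseteq> insert Leaf
       ((\<lambda>(l, r). Node l () r) ` ({t. size t \<le> n} \<times> {t. size t \<le> n}))" (is "_ \<subseteq> ?R")
    proof
      fix t :: pbtree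
      assume "t \<in> {t. size t \<le> Suc n}"
      then show "t \<in> ?R" by (cases t) auto
    qed
    then show ?case using Suc.IH by (meson finite.insertI finite_SigmaI finite_imageI finite_subset)
  qed simp
  then show ?thesis by (rule rev_finite_subset) auto
qed

end

theory Submission
  imports Defs
begin

text \<open>
  Each side has an innermost edge passing over it; connectedness and acyclicity make this a bijection
  between sides and edges, whose inverse is the labeling. Hence in the poset of a non-crossing tree
  the elements below or equal to \<open>j\<close> are the sides cut off by the edge labeled \<open>j\<close>, an interval of
  integers containing \<open>j\<close> (\<open>nct_poset_iff\<close>), and any two of these intervals are nested or disjoint
  because edges do not cross. So a permutation is a linear extension iff, for every \<open>j\<close>, the \<open>j\<close>-th
  letter of the word of its inverse is the maximum of the letters at the positions in the interval
  of \<open>j\<close>.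

  In a decreasing tree, the positions occupied by the subtree of a node form the longest interval
  around that node on which its letter is the maximum. The condition above therefore says that the
  subtree of the \<open>j\<close>-th node reaches at least so far to the left and to the right. It depends only on
  the shape of the tree (\<open>linear_extensions_iff_perm_shape\<close>). Since every shape occurs, the shapes
  that satisfy it form the only possible set \<open>I\<close> (\<open>sum_F_basis_eq_sum_P_basis_iff\<close>).

  The Tamari order is the pointwise order on the vectors of right subtree sizes, listed in inorder,
  and, by mirror symmetry, the reversed pointwise order on the vectors of left subtree sizes
  (\<open>tamari_le_iff_right_sizes\<close>, \<open>tamari_le_iff_left_sizes\<close>). So reaching far enough to the right is a
  lower bound for the tree and reaching far enough to the left is an upper bound. The intervals being
  nested, both bounds are attained by actual trees (\<open>tree_with_right_sizes\<close>,
  \<open>tree_with_left_sizes\<close>), which are the two ends of the Tamari interval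
  (\<open>bounded_trees_tamari_interval\<close>).
\<close>

section \<open>Subtree sizes and the Tamari order\<close>

fun right_sizes :: "'a tree \<Rightarrow> nat list" where
  "right_sizes Leaf = []"
| "right_sizes (Node l x r) = right_sizes l @ size r # right_sizes r"

fun left_sizes :: "'a tree \<Rightarrow> nat list" where
  "left_sizes Leaf = []"
| "left_sizes (Node l x r) = left_sizes l @ size l # left_sizes r"

lemma length_right_sizes [simp]: "length (right_sizes t) = size t"
  by (induction t) auto

lemma length_left_sizes [simp]: "length (left_sizes t) = size t"
  by (induction t) auto

lemma left_sizes_mirror: "left_sizes (mirror t) = rev (right_sizes t)"
  by (induction t) auto

lemma right_sizes_mirror: "right_sizes (mirror t) = rev (left_sizes t)"
  by (induction t) auto

lemma right_sizes_bound: "j < size t \<Longrightarrow> j + right_sizes t ! j < size t"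
proof (induction t arbitrary: j)
  case (Node l x r)
  consider "j < size l" | "j = size l" | k where "j = Suc (size l + k)"
    by (metis less_imp_Suc_add linorder_neqE_nat)
  then show ?case
  proof cases
    case 1
    then show ?thesis using Node.IH(1)[of j] by (simp add: nth_append)
  next
    case 3
    then show ?thesis using Node.IH(2)[of k] Node.prems by (simp add: nth_append)
  qed (simp add: nth_append)
qed simp

lemma left_sizes_bound: "j < size t \<Longrightarrow> left_sizes t ! j \<le> j"
proof (induction t arbitrary: j)
  case (Node l x r)
  consider "j < size l" | "j = size l" | k where "j = Suc (size l + k)"
    by (metis less_imp_Suc_add linorder_neqE_nat)
  then show ?case
  proof cases
    case 3
    then show ?thesis using Node.IH(2)[of k] Node.prems by (simp add: nth_append)
  qed (use Node in \<open>simp_all add: nth_append\<close>)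
qed simp

text \<open>The node following the subtree of node \<open>j\<close> in inorder, if there is one, is the ancestor that has
  node \<open>j\<close> in its left subtree, so its own left subtree reaches back at least to \<open>j\<close>, whereas the left
  subtrees of the nodes in the right subtree of \<open>j\<close> start after \<open>j\<close>. This lets a lower bound on right
  sizes be checked on a tree that is known only by its left sizes.\<close>

lemma right_sizes_iff_left_sizes:
  assumes "j + s < size t"
  shows "s \<le> right_sizes t ! j \<longleftrightarrow> (\<forall>k. j < k \<and> k \<le> j + s \<longrightarrow> j + left_sizes t ! k < k)"
  using assms
proof (induction t arbitrary: j)
  case (Node l x r)
  consider "j + s < size l" | "j < size l" "size l \<le> j + s" | "j = size l"
    | i where "j = Suc (size l + i)"
    by (metis less_imp_Suc_add linorder_neqE_nat not_le)
  then show ?case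
  proof cases
    case 1
    then show ?thesis using Node.IH(1)[of j] by (simp add: nth_append)
  next
    case 2
    have "j + right_sizes l ! j < size l"
      using 2 by (intro right_sizes_bound)
    \<comment> \<open>Here the range of \<open>k\<close> contains the root, whose left subtree contains \<open>j\<close>: both sides are false.\<close>
    then show ?thesis using 2 by (auto simp: nth_append intro!: exI[of _ "size l"])
  next
    case 3
    have "j + left_sizes (Node l x r) ! k < k" if "j < k" "k \<le> j + s" for k
    proof -
      obtain m where m: "k = Suc (size l + m)"
        using \<open>j < k\<close> 3 less_imp_Suc_add by blast
      show ?thesis using left_sizes_bound[of m r] m that 3 Node.prems by (simp add: nth_append)
    qed
    then show ?thesis using 3 Node.prems by (simp add: nth_append)
  next
    case 4
    have shift: "(\<forall>k. j < k \<and> k \<le> j + s \<longrightarrow> j + left_sizes (Node l x r) ! k < k)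
      \<longleftrightarrow> (\<forall>k. i < k \<and> k \<le> i + s \<longrightarrow> i + left_sizes r ! k < k)" (is "?A \<longleftrightarrow> ?B")
    proof
      assume A: ?A
      show ?B
      proof (intro allI impI)
        fix k assume "i < k \<and> k \<le> i + s"
        then show "i + left_sizes r ! k < k"
          using A[rule_format, of "Suc (size l + k)"] 4 by (simp add: nth_append)
      qed
    next
      assume B: ?B
      show ?A
      proof (intro allI impI)
        fix k assume k: "j < k \<and> k \<le> j + s"
        then obtain m where m: "k = Suc (size l + m)"
          using 4 less_imp_Suc_add[of "size l" k] by auto
        show "j + left_sizes (Node l x r) ! k < k"
          using B[rule_format, of m] 4 k m by (simp add: nth_append)
      qed
    qed
    show ?thesis unfolding shift using Node.IH(2)[of i] Node.prems 4 by (simp add: nth_append)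
  qed
qed simp

lemma tamari_le_node:
  assumes "tamari_le l l'" and "tamari_le r r'"
  shows "tamari_le (Node l x r) (Node l' x r')"
proof -
  have "rotation\<^sup>*\<^sup>* (Node l x r) (Node l' x r)"
    using assms(1) unfolding tamari_le_def
    by (induction rule: rtranclp_induct) (auto intro: rotation.left rtranclp.rtrancl_into_rtrancl)
  moreover have "rotation\<^sup>*\<^sup>* (Node l' x r) (Node l' x r')"
    using assms(2) unfolding tamari_le_def
    by (induction rule: rtranclp_induct) (auto intro: rotation.right rtranclp.rtrancl_into_rtrancl)
  ultimately show ?thesis unfolding tamari_le_def by (rule rtranclp_trans)
qed

lemma tamari_le_refl [simp]: "tamari_le t t"
  by (simp add: tamari_le_def)

lemma tamari_le_trans: "tamari_le s t \<Longrightarrow> tamari_le t u \<Longrightarrow> tamari_le s u"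
  unfolding tamari_le_def by (rule rtranclp_trans)

lemma tamari_le_rotate: "tamari_le (Node (Node a x b) y c) (Node a x (Node b y c))"
  unfolding tamari_le_def by (intro r_into_rtranclp rotation.root)

lemma list_all2_le_refl [simp]: "list_all2 (\<le>) xs (xs :: nat list)"
  by (simp add: list.rel_refl)

lemma size_rotation: "rotation t t' \<Longrightarrow> size t = size t'"
  by (induction rule: rotation.induct) auto

lemma right_sizes_rotation:
  "rotation t t' \<Longrightarrow> list_all2 (\<le>) (right_sizes t) (right_sizes t')"
  by (induction rule: rotation.induct)
    (auto intro!: list_all2_appendI dest: size_rotation)

lemma right_sizes_tamari_le:
  assumes "tamari_le t t'"
  shows "list_all2 (\<le>) (right_sizes t) (right_sizes t')"
  using assms unfolding tamari_le_def
proof (induction rule: rtranclp_induct)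
  case (step u v)
  show ?case
    by (rule list_all2_trans[OF _ step.IH right_sizes_rotation[OF step.hyps(2)]]) simp
qed simp

text \<open>The hypothesis says that no node before \<open>i\<close> has \<open>i\<close> in its right subtree, which means that node
  \<open>i\<close> lies on the left spine. Rotating it upwards along the spine moves upwards in the Tamari order,
  and enlarges the right subtree of node \<open>i\<close> only.\<close>

lemma raise_left_spine_node:
  fixes t :: pbtree
  assumes "i < size t" and "\<And>p. p < i \<Longrightarrow> p + right_sizes t ! p < i"
  shows "\<exists>a b. size a = i \<and> tamari_le t (Node a () b) \<and>
           right_sizes (Node a () b) = (right_sizes t)[i := size t - 1 - i]"
  using assms
proof (induction t)
  case (Node l x r)
  consider "i < size l" | "i = size l" | "size l < i" by linarith
  then show ?case
  proof cases
    case 1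
    have "p + right_sizes l ! p < i" if "p < i" for p
      using Node.prems(2)[OF that] that 1 by (simp add: nth_append)
    from Node.IH(1)[OF 1 this] obtain a b where ab: "size a = i" "tamari_le l (Node a () b)"
      "right_sizes (Node a () b) = (right_sizes l)[i := size l - 1 - i]" by blast
    have "tamari_le (Node l x r) (Node (Node a () b) () r)"
      using tamari_le_node[OF ab(2) tamari_le_refl] by simp
    then have "tamari_le (Node l x r) (Node a () (Node b () r))"
      using tamari_le_rotate tamari_le_trans by blast
    moreover have "right_sizes a @ size (Node b () r) # right_sizes b
        = (right_sizes l)[i := size (Node l x r) - 1 - i]"
    proof -
      have len: "size l = Suc (size a + size b)"
        using arg_cong[OF ab(3), of length] by simp
      have "(right_sizes l)[i := y] = right_sizes a @ y # right_sizes b" for y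
      proof -
        have "(right_sizes l)[i := y] = (right_sizes (Node a () b))[i := y]"
          unfolding ab(3) by simp
        also have "\<dots> = right_sizes a @ y # right_sizes b"
          using ab(1) by (simp add: list_update_append)
        finally show ?thesis .
      qed
      then show ?thesis using len ab(1) by simp
    qed
    ultimately show ?thesis using ab(1) 1
      by (intro exI[of _ a] exI[of _ "Node b () r"]) (simp add: list_update_append)
  next
    case 2
    then show ?thesis
      by (intro exI[of _ l] exI[of _ r]) (simp add: list_update_append)
  next
    case 3
    then show ?thesis using Node.prems(2)[of "size l"] Node.prems(1) by (simp add: nth_append)
  qed
qed simp

text \<open>The node of \<open>t\<close> at the position of the root of \<open>t'\<close> lies on the left spine of \<open>t\<close>: earlier nodes
  of \<open>t'\<close> do not reach that position, so by hypothesis those of \<open>t\<close> do not either. After raising it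
  to the root, the two subtrees can be compared separately.\<close>

lemma tamari_le_if_right_sizes:
  fixes t t' :: pbtree
  assumes "list_all2 (\<le>) (right_sizes t) (right_sizes t')"
  shows "tamari_le t t'"
  using assms
proof (induction t' arbitrary: t)
  case Leaf
  then show ?case by (cases t) auto
next
  case (Node l' x r')
  let ?t' = "Node l' x r'" and ?i = "size l'"
  have sz: "size t = size ?t'"
    using list_all2_lengthD[OF Node.prems] by simp
  have le: "right_sizes t ! p \<le> right_sizes ?t' ! p" if "p < size t" for p
    using list_all2_nthD[OF Node.prems, of p] that by simp
  have "p + right_sizes t ! p < ?i" if "p < ?i" for p
    using le[of p] right_sizes_bound[OF that] that sz by (simp add: nth_append)
  from raise_left_spine_node[OF _ this] obtain a b where ab: "size a = ?i"
    "tamari_le t (Node a () b)"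
    "right_sizes (Node a () b) = (right_sizes t)[?i := size t - 1 - ?i]"
    using sz by auto
  have "list_all2 (\<le>) ((right_sizes t)[?i := size t - 1 - ?i]) ((right_sizes ?t')[?i := size r'])"
    using Node.prems sz by (intro list_all2_update_cong) auto
  then have "list_all2 (\<le>) (right_sizes (Node a () b)) (right_sizes ?t')"
    unfolding ab(3) by (simp add: list_update_append)
  then have "list_all2 (\<le>) (right_sizes a) (right_sizes l')"
    "list_all2 (\<le>) (right_sizes b) (right_sizes r')"
    using ab(1) by (auto simp: list_all2_append)
  then have "tamari_le (Node a () b) ?t'"
    using tamari_le_node Node.IH by simp
  then show ?case using ab(2) tamari_le_trans by blast
qed

lemma tamari_le_iff_right_sizes:
  "tamari_le t t' \<longleftrightarrow> list_all2 (\<le>) (right_sizes t) (right_sizes t')"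
  using right_sizes_tamari_le tamari_le_if_right_sizes by blast

lemma rotation_mirror: "rotation t t' \<Longrightarrow> rotation (mirror t') (mirror t)"
  by (induction rule: rotation.induct) (auto intro: rotation.intros)

lemma tamari_le_mirror: "tamari_le t t' \<Longrightarrow> tamari_le (mirror t') (mirror t)"
  unfolding tamari_le_def
  by (induction rule: rtranclp_induct)
    (auto intro: rotation_mirror converse_rtranclp_into_rtranclp)

lemma tamari_le_iff_left_sizes:
  "tamari_le t t' \<longleftrightarrow> list_all2 (\<le>) (left_sizes t') (left_sizes t)"
proof -
  have "tamari_le t t' \<longleftrightarrow> tamari_le (mirror t') (mirror t)"
    using tamari_le_mirror[of t t'] tamari_le_mirror[of "mirror t'" "mirror t"] by auto
  then show ?thesis
    by (simp add: tamari_le_iff_right_sizes right_sizes_mirror)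
qed

text \<open>The root must be the first node whose right subtree reaches the end of the tree; the entries
  before and after it satisfy the same two conditions.\<close>

lemma tree_with_right_sizes:
  fixes v :: "nat list"
  assumes "\<And>j. j < length v \<Longrightarrow> j + v ! j < length v"
    and "\<And>j k. j \<le> k \<Longrightarrow> k \<le> j + v ! j \<Longrightarrow> j < length v \<Longrightarrow> k + v ! k \<le> j + v ! j"
  shows "\<exists>t :: pbtree. right_sizes t = v"
  using assms
proof (induction v rule: length_induct)
  case (1 v)
  note bound = "1.prems"(1) and nest = "1.prems"(2)
  show ?case
  proof (cases "v = []")
    case True
    then show ?thesis by (intro exI[of _ Leaf]) simp
  next
    case False
    define reaches where "reaches i \<longleftrightarrow> i < length v \<and> i + v ! i = length v - 1" for i
    define i where "i = (LEAST i. reaches i)"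
    have "reaches (length v - 1)"
      using bound[of "length v - 1"] False by (auto simp: reaches_def)
    then have "reaches i" unfolding i_def by (rule LeastI)
    then have i: "i < length v" "i + v ! i = length v - 1" by (auto simp: reaches_def)
    \<comment> \<open>A node reaching position \<open>i\<close> would contain node \<open>i\<close>, hence reach the end as well.\<close>
    have before: "p + v ! p < i" if "p < i" for p
    proof (rule ccontr)
      assume "\<not> p + v ! p < i"
      then have "i + v ! i \<le> p + v ! p"
        using nest[of p i] that i by simp
      then have "reaches p"
        using bound[of p] that i by (auto simp: reaches_def)
      then show False using that not_less_Least unfolding i_def by blast
    qed
    have "\<exists>l :: pbtree. right_sizes l = take i v"
    proof (rule "1.IH"[rule_format])
      show "length (take i v) < length v" using i by simp
      show "j + take i v ! j < length (take i v)" if "j < length (take i v)" for j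
        using before[of j] that i by simp
      show "k + take i v ! k \<le> j + take i v ! j"
        if "j \<le> k" "k \<le> j + take i v ! j" "j < length (take i v)" for j k
        using before[of j] nest[of j k] that i by simp
    qed
    moreover have "\<exists>r :: pbtree. right_sizes r = drop (Suc i) v"
    proof (rule "1.IH"[rule_format])
      show "length (drop (Suc i) v) < length v" using i by auto
      show "j + drop (Suc i) v ! j < length (drop (Suc i) v)" if "j < length (drop (Suc i) v)" for j
      proof -
        have "Suc (i + j) < length v" using that by simp
        then show ?thesis using bound[of "Suc (i + j)"] by simp
      qed
      show "k + drop (Suc i) v ! k \<le> j + drop (Suc i) v ! j"
        if "j \<le> k" "k \<le> j + drop (Suc i) v ! j" "j < length (drop (Suc i) v)" for j k
        using nest[of "Suc (i + j)" "Suc (i + k)"] bound[of "Suc (i + j)"] that i by simp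
    qed
    ultimately obtain l r :: pbtree where lr: "right_sizes l = take i v" "right_sizes r = drop (Suc i) v"
      by blast
    have "size r = v ! i"
      using arg_cong[OF lr(2), of length] i by simp
    then have "right_sizes (Node l () r) = v"
      using lr i by (simp add: id_take_nth_drop[symmetric])
    then show ?thesis by blast
  qed
qed

lemma tree_with_left_sizes:
  fixes v :: "nat list"
  assumes "\<And>j. j < length v \<Longrightarrow> v ! j \<le> j"
    and "\<And>j k. k \<le> j \<Longrightarrow> j \<le> k + v ! j \<Longrightarrow> j < length v \<Longrightarrow> j + v ! k \<le> k + v ! j"
  shows "\<exists>t :: pbtree. left_sizes t = v"
proof -
  have "\<exists>t :: pbtree. right_sizes t = rev v"
  proof (rule tree_with_right_sizes)
    show "j + rev v ! j < length (rev v)" if "j < length (rev v)" for j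
    proof -
      have "length v - Suc j < length v" using that by auto
      then show ?thesis using assms(1)[of "length v - Suc j"] that by (simp add: rev_nth)
    qed
    show "k + rev v ! k \<le> j + rev v ! j"
      if "j \<le> k" "k \<le> j + rev v ! j" "j < length (rev v)" for j k
    proof -
      have j: "length v - Suc j < length v" using that by auto
      then have "k < length v"
        using assms(1)[of "length v - Suc j"] that by (simp add: rev_nth)
      moreover have "length v - Suc j + v ! (length v - Suc k) \<le> length v - Suc k + v ! (length v - Suc j)"
        using that j by (intro assms(2)) (auto simp: rev_nth)
      ultimately show ?thesis using that by (simp add: rev_nth)
    qed
  qed
  then obtain t :: pbtree where "right_sizes t = rev v" by blast
  then have "left_sizes (mirror t) = v" by (simp add: left_sizes_mirror)
  then show ?thesis by blast
qed

section \<open>Shapes of decreasing trees\<close>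

lemma right_sizes_tree_shape [simp]: "right_sizes (tree_shape t) = right_sizes t"
  unfolding tree_shape_def by (induction t) auto

lemma left_sizes_tree_shape [simp]: "left_sizes (tree_shape t) = left_sizes t"
  unfolding tree_shape_def by (induction t) auto

lemma size_tree_shape [simp]: "size (tree_shape t) = size t"
  by (simp add: tree_shape_def)

lemma decreasing_tree_Nil [simp]: "decreasing_tree [] = Leaf"
  by (simp add: decreasing_tree.simps)

lemma decreasing_tree_append:
  assumes "\<forall>x\<in>set u \<union> set v. x < m"
  shows "decreasing_tree (u @ m # v) = Node (decreasing_tree u) m (decreasing_tree v)"
proof -
  have "Max (set (u @ m # v)) = m"
    using assms by (intro Max_eqI) (auto simp: less_imp_le)
  moreover have "takeWhile (\<lambda>x. x \<noteq> m) (u @ m # v) = u" "dropWhile (\<lambda>x. x \<noteq> m) (u @ m # v) = m # v"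
    using assms by (subst takeWhile_append2 dropWhile_append2; force)+
  ultimately show ?thesis
    by (subst decreasing_tree.simps) (simp add: Let_def)
qed

text \<open>Splitting a word at its maximum is the recursion that defines decreasing trees.\<close>

lemma distinct_word_max_induct [consumes 1, case_names Nil max]:
  fixes w :: "'a::linorder list"
  assumes "distinct w" and "P []"
    and step: "\<And>u m v. \<forall>x\<in>set u \<union> set v. x < m \<Longrightarrow> distinct u \<Longrightarrow> distinct v \<Longrightarrow>
      P u \<Longrightarrow> P v \<Longrightarrow> P (u @ m # v)"
  shows "P w"
  using assms(1)
proof (induction w rule: length_induct)
  case (1 w)
  show ?case
  proof (cases "w = []")
    case False
    then have "Max (set w) \<in> set w" by simp
    then obtain u v where w: "w = u @ Max (set w) # v" by (meson split_list)
    define m where "m = Max (set w)"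
    have w: "w = u @ m # v" using w m_def by simp
    have "\<forall>x\<in>set u \<union> set v. x < m"
    proof
      fix x assume "x \<in> set u \<union> set v"
      note that = this
      have "x \<le> m" unfolding m_def using that w by (intro Max_ge) auto
      moreover have "x \<noteq> m" using that "1.prems" w by auto
      ultimately show "x < m" by simp
    qed
    moreover have "distinct u" "distinct v" "P u" "P v" using "1.IH" "1.prems" w by auto
    ultimately show ?thesis unfolding w by (rule step)
  qed (simp add: assms(2))
qed

lemma size_decreasing_tree [simp]: "distinct w \<Longrightarrow> size (decreasing_tree w) = length w"
  by (induction rule: distinct_word_max_induct) (simp_all add: decreasing_tree_append)

lemma decreasing_tree_rev: "distinct w \<Longrightarrow> decreasing_tree (rev w) = mirror (decreasing_tree w)"
  by (induction rule: distinct_word_max_induct) (simp_all add: decreasing_tree_append Un_commute)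

text \<open>The right subtree of node \<open>j\<close> consists of the maximal run of letters smaller than the letter
  \<open>w ! j\<close> immediately to its right.\<close>

lemma right_sizes_decreasing_tree:
  assumes "distinct w" and "j + s < length w"
  shows "s \<le> right_sizes (decreasing_tree w) ! j \<longleftrightarrow> (\<forall>k. j < k \<and> k \<le> j + s \<longrightarrow> w ! k < w ! j)"
  using assms
proof (induction arbitrary: j rule: distinct_word_max_induct)
    case (max u m v)
    note d = max.hyps(2,3)
    consider "j + s < length u" | "j < length u" "length u \<le> j + s" | "j = length u"
      | i where "j = Suc (length u + i)"
      by (metis less_imp_Suc_add linorder_neqE_nat not_le)
    then show ?case
    proof cases
      case 1
      then show ?thesis using max.IH(1)[of j] d max.hyps
        by (simp add: nth_append decreasing_tree_append)
    next
      case 2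
      then have "u ! j < m" using max.hyps(1) by simp
      then have "\<not> m < u ! j" by simp
      moreover have "j + right_sizes (decreasing_tree u) ! j < length u"
        using right_sizes_bound[of j "decreasing_tree u"] 2 d by simp
      ultimately show ?thesis using 2 d max.hyps
        by (auto simp: nth_append decreasing_tree_append intro!: exI[of _ "length u"])
    next
      case 3
      have "(u @ m # v) ! k < (u @ m # v) ! j" if "j < k" "k \<le> j + s" for k
        using that 3 max.prems max.hyps(1) less_imp_Suc_add[of j k] by (auto simp: nth_append)
      moreover have "s \<le> right_sizes (decreasing_tree (u @ m # v)) ! j"
        using 3 d max.hyps max.prems by (simp add: nth_append decreasing_tree_append)
      ultimately show ?thesis by blast
    next
      case 4
      have "(\<forall>k. j < k \<and> k \<le> j + s \<longrightarrow> (u @ m # v) ! k < (u @ m # v) ! j)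
        \<longleftrightarrow> (\<forall>k. i < k \<and> k \<le> i + s \<longrightarrow> v ! k < v ! i)" (is "?A \<longleftrightarrow> ?B")
      proof
        assume A: ?A
        show ?B
        proof (intro allI impI)
          fix k assume "i < k \<and> k \<le> i + s"
          then show "v ! k < v ! i"
            using A[rule_format, of "Suc (length u + k)"] 4 by (simp add: nth_append)
        qed
      next
        assume B: ?B
        show ?A
        proof (intro allI impI)
          fix k assume k: "j < k \<and> k \<le> j + s"
          then obtain l where "k = Suc (length u + l)"
            using 4 less_imp_Suc_add[of "length u" k] by auto
          then show "(u @ m # v) ! k < (u @ m # v) ! j"
            using B[rule_format, of l] 4 k by (simp add: nth_append)
        qed
      qed
      then show ?thesis using max.IH(2)[of i] d 4 max.prems max.hyps
        by (simp add: nth_append decreasing_tree_append)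
    qed
qed simp

lemma left_sizes_decreasing_tree:
  assumes "distinct w" and "s \<le> j" and "j < length w"
  shows "s \<le> left_sizes (decreasing_tree w) ! j \<longleftrightarrow> (\<forall>k. j \<le> k + s \<and> k < j \<longrightarrow> w ! k < w ! j)"
proof -
  let ?n = "length w" and ?j = "length w - Suc j"
  have j: "?j < ?n" "?j + s < ?n" "?n - Suc ?j = j" using assms by auto
  have "left_sizes (decreasing_tree w) ! j = right_sizes (decreasing_tree (rev w)) ! ?j"
    using assms j by (simp add: decreasing_tree_rev right_sizes_mirror rev_nth)
  then have "s \<le> left_sizes (decreasing_tree w) ! j
      \<longleftrightarrow> (\<forall>k. ?j < k \<and> k \<le> ?j + s \<longrightarrow> rev w ! k < rev w ! ?j)"
    using right_sizes_decreasing_tree[of "rev w" ?j s] assms(1) j by simp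
  also have "\<dots> \<longleftrightarrow> (\<forall>k. j \<le> k + s \<and> k < j \<longrightarrow> w ! k < w ! j)" (is "?A \<longleftrightarrow> ?B")
  proof
    assume A: ?A
    show ?B
    proof (intro allI impI)
      fix k assume k: "j \<le> k + s \<and> k < j"
      then have "?j < ?n - Suc k" "?n - Suc k \<le> ?j + s" "?n - Suc k < ?n" "?n - Suc (?n - Suc k) = k"
        using assms by auto
      then show "w ! k < w ! j"
        using A[rule_format, of "?n - Suc k"] j by (simp add: rev_nth)
    qed
  next
    assume B: ?B
    show ?A
    proof (intro allI impI)
      fix k assume k: "?j < k \<and> k \<le> ?j + s"
      then have "k < ?n" "j \<le> ?n - Suc k + s" "?n - Suc k < j"
        using assms by auto
      then show "rev w ! k < rev w ! ?j"
        using B[rule_format, of "?n - Suc k"] j by (simp add: rev_nth)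
    qed
  qed
  finally show ?thesis .
qed

section \<open>Sums over permutations with prescribed shapes\<close>

text \<open>A word whose decreasing tree has the given shape: the root receives the largest of the letters
  \<open>k + 1, ..., k + size t\<close>, and the left subtree receives the smallest ones.\<close>

fun decreasing_word :: "nat \<Rightarrow> 'a tree \<Rightarrow> nat list" where
  "decreasing_word k Leaf = []"
| "decreasing_word k (Node l x r) =
     decreasing_word k l @ (k + size l + size r + 1) # decreasing_word (k + size l) r"

lemma set_decreasing_word: "set (decreasing_word k t) = {k + 1..k + size t}"
  by (induction t arbitrary: k) auto

lemma distinct_decreasing_word: "distinct (decreasing_word k t)"
  by (induction t arbitrary: k) (auto simp: set_decreasing_word)

lemma tree_shape_decreasing_word: "tree_shape (decreasing_tree (decreasing_word k t)) = t"
proof (induction t arbitrary: k)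
  case (Node l x r)
  have "decreasing_tree (decreasing_word k (Node l x r)) = Node (decreasing_tree (decreasing_word k l))
      (k + size l + size r + 1) (decreasing_tree (decreasing_word (k + size l) r))"
    unfolding decreasing_word.simps
    by (rule decreasing_tree_append) (auto simp: set_decreasing_word)
  then show ?case using Node.IH by (simp add: tree_shape_def)
qed (simp add: tree_shape_def)

lemma perm_fun_permutes: "perm_fun \<sigma> permutes {1..perm_size \<sigma>}"
  using Rep_fin_perm[of \<sigma>] by (simp add: perm_fun_def perm_size_def case_prod_beta)

lemma length_inv_word [simp]: "length (inv_word \<sigma>) = perm_size \<sigma>"
  by (simp add: inv_word_def)

lemma nth_inv_word: "j < perm_size \<sigma> \<Longrightarrow> inv_word \<sigma> ! j = inv (perm_fun \<sigma>) (Suc j)"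
  unfolding inv_word_def by (subst nth_map) (simp_all del: upt_Suc)

lemma distinct_inv_word [simp]: "distinct (inv_word \<sigma>)"
  unfolding inv_word_def distinct_map
  using permutes_inj[OF permutes_inv[OF perm_fun_permutes]] by (auto intro: inj_on_subset)

lemma fin_perm_with_inv_word:
  assumes "distinct w" and "set w = {1..n}"
  shows "\<exists>\<sigma>. perm_size \<sigma> = n \<and> inv_word \<sigma> = w"
proof -
  have len: "length w = n" using assms distinct_card by fastforce
  define f where "f i = (if i \<in> {1..n} then w ! (i - 1) else i)" for i
  have "inj_on f {1..n}"
    using assms(1) len by (auto simp: inj_on_def f_def nth_eq_iff_index_eq)
  moreover have "f ` {1..n} \<subseteq> {1..n}"
  proof
    fix y assume "y \<in> f ` {1..n}"
    then obtain i where i: "i \<in> {1..n}" "y = w ! (i - 1)" by (auto simp: f_def)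
    then have "y \<in> set w" using len by (auto simp: in_set_conv_nth intro!: exI[of _ "i - 1"])
    then show "y \<in> {1..n}" using assms(2) by simp
  qed
  ultimately have "bij_betw f {1..n} {1..n}"
    by (simp add: bij_betw_def endo_inj_surj)
  then have f: "f permutes {1..n}"
    by (rule bij_imp_permutes) (auto simp: f_def)
  define \<sigma> where "\<sigma> = Abs_fin_perm (n, inv f)"
  have rep: "Rep_fin_perm \<sigma> = (n, inv f)"
    unfolding \<sigma>_def using permutes_inv[OF f] by (intro Abs_fin_perm_inverse) simp
  then have \<sigma>: "perm_size \<sigma> = n" "perm_fun \<sigma> = inv f"
    by (simp_all add: perm_size_def perm_fun_def)
  have "inv_word \<sigma> = w"
  proof (rule nth_equalityI)
    fix j assume "j < length (inv_word \<sigma>)"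
    then show "inv_word \<sigma> ! j = w ! j"
      using permutes_inv_inv[OF f] by (simp add: nth_inv_word \<sigma> f_def)
  qed (simp add: \<sigma> len)
  then show ?thesis using \<sigma>(1) by blast
qed

definition perm_shape :: "fin_perm \<Rightarrow> pbtree" where
  "perm_shape \<sigma> = tree_shape (decreasing_tree (inv_word \<sigma>))"

lemma size_perm_shape [simp]: "size (perm_shape \<sigma>) = perm_size \<sigma>"
  by (simp add: perm_shape_def)

text \<open>This is what makes the elements \<open>P_basis t\<close> nonzero, hence the set \<open>I\<close> unique.\<close>

lemma perm_shape_surj: "\<exists>\<sigma>. perm_shape \<sigma> = t"
proof -
  obtain \<sigma> where "inv_word \<sigma> = decreasing_word 0 t"
    using fin_perm_with_inv_word[of "decreasing_word 0 t" "size t"]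
    by (auto simp: distinct_decreasing_word set_decreasing_word)
  then have "perm_shape \<sigma> = t"
    by (simp add: perm_shape_def tree_shape_decreasing_word)
  then show ?thesis ..
qed

lemma lookup_sum_F_basis:
  assumes "finite S"
  shows "Poly_Mapping.lookup (\<Sum>\<sigma>\<in>S. F_basis \<sigma> :: 'k::field fqsym) \<tau> = of_bool (\<tau> \<in> S)"
  using assms
  by (simp add: lookup_sum F_basis_def lookup_single when_def of_bool_def)

lemma sum_P_basis:
  assumes "I \<subseteq> {t. size t = n}"
  shows "(\<Sum>t\<in>I. P_basis t :: 'k::field fqsym) = (\<Sum>\<sigma> | perm_size \<sigma> = n \<and> perm_shape \<sigma> \<in> I. F_basis \<sigma>)"
proof -
  let ?S = "{\<sigma>. perm_size \<sigma> = n \<and> perm_shape \<sigma> \<in> I}"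
  have fin: "finite ?S" by (rule finite_subset[OF _ finite_fin_perm[of n]]) auto
  have finI: "finite I" using assms finite_pbtree finite_subset by blast
  have "(\<Sum>t\<in>I. P_basis t :: 'k fqsym) = (\<Sum>t\<in>I. \<Sum>\<sigma> | \<sigma> \<in> ?S \<and> perm_shape \<sigma> = t. F_basis \<sigma>)"
  proof (rule sum.cong[OF refl])
    fix t assume "t \<in> I"
    then have "{\<sigma>. perm_size \<sigma> = size t \<and> perm_shape \<sigma> = t} = {\<sigma>. \<sigma> \<in> ?S \<and> perm_shape \<sigma> = t}"
      using assms by auto
    then show "P_basis t = (\<Sum>\<sigma> | \<sigma> \<in> ?S \<and> perm_shape \<sigma> = t. F_basis \<sigma> :: 'k fqsym)"
      by (simp add: P_basis_def perm_shape_def)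
  qed
  also have "\<dots> = (\<Sum>\<sigma>\<in>?S. F_basis \<sigma>)"
    by (rule sum.group[OF fin finI]) auto
  finally show ?thesis .
qed

text \<open>Both sides are sums of distinct basis elements, so they agree iff they run over the same
  permutations; as every tree is the shape of some permutation, this forces \<open>I = J\<close>.\<close>

lemma sum_F_basis_eq_sum_P_basis_iff:
  assumes L: "L = {\<sigma>. perm_size \<sigma> = n \<and> perm_shape \<sigma> \<in> J}"
    and J: "J \<subseteq> {t. size t = n}" and I: "I \<subseteq> {t. size t = n}"
  shows "(\<Sum>\<sigma>\<in>L. F_basis \<sigma> :: 'k::field fqsym) = (\<Sum>t\<in>I. P_basis t) \<longleftrightarrow> I = J"
proof
  assume eq: "(\<Sum>\<sigma>\<in>L. F_basis \<sigma> :: 'k::field fqsym) = (\<Sum>t\<in>I. P_basis t)"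
  have fin: "finite {\<sigma>. perm_size \<sigma> = n \<and> perm_shape \<sigma> \<in> K}" for K
    by (rule finite_subset[OF _ finite_fin_perm[of n]]) auto
  have "perm_shape \<sigma> \<in> J \<longleftrightarrow> perm_shape \<sigma> \<in> I" if "perm_size \<sigma> = n" for \<sigma>
    using arg_cong[OF eq, of "\<lambda>p. Poly_Mapping.lookup p \<sigma>"] that
    unfolding sum_P_basis[OF I] L
    by (auto simp: lookup_sum_F_basis[OF fin] of_bool_def split: if_splits)
  then have "t \<in> J \<longleftrightarrow> t \<in> I" if "size t = n" for t
    using perm_shape_surj[of t] that by (metis size_perm_shape)
  then show "I = J" using I J by auto
next
  assume "I = J"
  then show "(\<Sum>\<sigma>\<in>L. F_basis \<sigma> :: 'k::field fqsym) = (\<Sum>t\<in>I. P_basis t)"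
    using sum_P_basis[OF I, where 'k = 'k] L by simp
qed

section \<open>Sides and edges of a non-crossing tree\<close>

text \<open>The edge \<open>{a, b}\<close> is the first one met on the way from side \<open>i\<close> to the base. It is the
  edge that gets the label \<open>i\<close>, see \<open>innermost_edge_label\<close> below.\<close>

definition innermost_edge :: "nat set set \<Rightarrow> nat \<Rightarrow> nat \<Rightarrow> nat \<Rightarrow> bool" where
  "innermost_edge E i a b \<longleftrightarrow> {a, b} \<in> E \<and> a < i \<and> i \<le> b \<and>
     (\<forall>c d. {c, d} \<in> E \<and> c < i \<and> i \<le> d \<longrightarrow> c \<le> a \<and> b \<le> d)"

lemma innermost_edge_unique:
  "innermost_edge E i a b \<Longrightarrow> innermost_edge E i c d \<Longrightarrow> c = a \<and> d = b"
  unfolding innermost_edge_def by (meson le_antisym)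

locale nc_tree =
  fixes n :: nat and E :: "nat set set"
  assumes noncrossing_tree: "noncrossing_tree n E"
begin

lemma edge_bound: "{a, b} \<in> E \<Longrightarrow> a < b \<Longrightarrow> b \<le> n"
  using noncrossing_tree by (auto simp: noncrossing_tree_def tree_on_def)

lemma not_crossing: "{a, b} \<in> E \<Longrightarrow> {c, d} \<in> E \<Longrightarrow> a < c \<Longrightarrow> c < b \<Longrightarrow> b < d \<Longrightarrow> False"
  using noncrossing_tree unfolding noncrossing_tree_def crossing_def by blast

lemma no_cycle: "\<not> graph_cycle E vs"
  using noncrossing_tree by (auto simp: noncrossing_tree_def tree_on_def)

text \<open>Connectedness in terms of cuts.\<close>

lemma cut_edge:
  assumes "u \<in> X" "u \<le> n" "v \<notin> X" "v \<le> n"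
  shows "\<exists>x y. {x, y} \<in> E \<and> x \<in> X \<and> y \<notin> X"
proof (rule ccontr)
  assume none: "\<not> ?thesis"
  have "(u, v) \<in> {(x, y). {x, y} \<in> E}\<^sup>*"
    using noncrossing_tree assms by (auto simp: noncrossing_tree_def tree_on_def connected_graph_def)
  then have "v \<in> X"
    by (induction rule: rtrancl_induct) (use assms(1) none in auto)
  then show False using assms(3) by contradiction
qed

text \<open>Connectedness gives an edge from the vertices before side \<open>i\<close> to those after it. The edges over
  side \<open>i\<close> do not cross, so they form a chain, and the shortest is innermost.\<close>

lemma innermost_edge_exists:
  assumes "1 \<le> i" "i \<le> n"
  shows "\<exists>a b. innermost_edge E i a b"
proof -
  let ?C = "\<lambda>(a, b). {a, b} \<in> E \<and> a < i \<and> i \<le> b"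
  obtain x y where "{x, y} \<in> E" "x < i" "\<not> y < i"
    using cut_edge[of 0 "{..<i}" n] assms by auto
  then have "?C (x, y)" by simp
  then obtain e where e: "?C e" and min: "\<And>f. ?C f \<Longrightarrow> snd e - fst e \<le> snd f - fst f"
    using ex_has_least_nat[of ?C "(x, y)" "\<lambda>(a, b). b - a"] by (auto simp: case_prod_beta)
  obtain a b where ab: "e = (a, b)" by fastforce
  have "c \<le> a \<and> b \<le> d" if cd: "{c, d} \<in> E" "c < i" "i \<le> d" for c d
  proof -
    have "b - a \<le> d - c" using min[of "(c, d)"] cd ab by simp
    moreover have "\<not> (a < c \<and> b < d)" "\<not> (c < a \<and> d < b)"
      using not_crossing[of a b c d] not_crossing[of c d a b] e ab cd by auto
    ultimately show ?thesis using e ab cd by auto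
  qed
  then show ?thesis using e ab unfolding innermost_edge_def by blast
qed

text \<open>If two sides \<open>i < j\<close> had the same innermost edge \<open>{a, b}\<close>, an edge leaving the set of vertices
  \<open>{i..<j}\<close> would pass over one of these sides, hence contain \<open>{a, b}\<close>, which is impossible for an
  edge with an endpoint strictly between \<open>a\<close> and \<open>b\<close>. So this set would be a union of components.\<close>

lemma innermost_side_unique:
  assumes "innermost_edge E i a b" "innermost_edge E j a b"
  shows "i = j"
proof -
  have False if i: "innermost_edge E i a b" and j: "innermost_edge E j a b" and "i < j" for i j
  proof -
    have bounds: "a < i" "j \<le> b" "b \<le> n"
      using i j edge_bound[of a b] by (auto simp: innermost_edge_def)
    obtain x y where xy: "{x, y} \<in> E" "i \<le> x" "x < j" "\<not> (i \<le> y \<and> y < j)"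
      using cut_edge[of i "{i..<j}" a] \<open>i < j\<close> bounds by auto
    show False
    proof (cases "y < i")
      case True
      then have "b \<le> x"
        using i xy unfolding innermost_edge_def by (metis insert_commute)
      then show ?thesis using xy bounds by simp
    next
      case False
      then have "{x, y} \<in> E \<and> x < j \<and> j \<le> y" using xy by auto
      then have "x \<le> a" using j unfolding innermost_edge_def by blast
      then show ?thesis using xy bounds by simp
    qed
  qed
  then show ?thesis using assms by (metis linorder_neqE_nat)
qed

text \<open>Suppose that the edges strictly below \<open>{a, b}\<close> cover all sides between \<open>a\<close> and \<open>b\<close>. From a vertex
  that lies strictly under none of them, the longest of them that starts at that vertex leads to
  another such vertex. Continuing, one walks to \<open>b\<close> along edges below \<open>{a, b}\<close>.\<close>

lemma path_from_uncovered_vertex: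
  assumes cover: "\<And>i. a < i \<Longrightarrow> i \<le> b \<Longrightarrow> \<exists>c d. {c, d} \<in> E \<and> separates_edge a b c d \<and> c < i \<and> i \<le> d"
    and "a \<le> x" "x < b"
    and "\<And>c d. {c, d} \<in> E \<Longrightarrow> separates_edge a b c d \<Longrightarrow> \<not> (c < x \<and> x < d)"
  shows "\<exists>vs. sorted_wrt (<) (x # vs) \<and> vs \<noteq> [] \<and> last vs = b \<and>
           successively (\<lambda>c d. {c, d} \<in> E \<and> separates_edge a b c d) (x # vs)"
  using assms(2-)
proof (induction "b - x" arbitrary: x rule: less_induct)
  case less
  let ?S = "\<lambda>d. {x, d} \<in> E \<and> separates_edge a b x d"
  obtain c d where "{c, d} \<in> E" "separates_edge a b c d" "c < Suc x" "Suc x \<le> d"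
    using cover[of "Suc x"] less.prems by auto
  moreover from this have "c = x" using less.prems(3)[of c d] by auto
  ultimately have "?S d" by simp
  define y where "y = (GREATEST d. ?S d)"
  have bound: "d \<le> b" if "?S d" for d using that by (simp add: separates_edge_def)
  have y: "?S y" unfolding y_def using \<open>?S d\<close> bound by (rule GreatestI_nat)
  have max: "d \<le> y" if "?S d" for d unfolding y_def using that bound by (rule Greatest_le_nat)
  have "x < y" "y \<le> b" using y by (auto simp: separates_edge_def)
  show ?case
  proof (cases "y = b")
    case True
    then show ?thesis using y \<open>x < y\<close> by (intro exI[of _ "[y]"]) simp
  next
    case False
    have "\<not> (c < y \<and> y < d)" if cd: "{c, d} \<in> E" "separates_edge a b c d" for c d
    proof
      assume "c < y \<and> y < d"
      then have "c \<le> x" using not_crossing[of x y c d] cd y by force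
      then show False
        using max[of d] less.prems(3)[of c d] cd \<open>c < y \<and> y < d\<close> \<open>x < y\<close> by (cases "c = x") auto
    qed
    then obtain vs where vs: "sorted_wrt (<) (y # vs)" "vs \<noteq> []" "last vs = b"
      "successively (\<lambda>c d. {c, d} \<in> E \<and> separates_edge a b c d) (y # vs)"
      using less.hyps[of y] \<open>x < y\<close> \<open>y \<le> b\<close> False less.prems(1) by force
    then show ?thesis using y \<open>x < y\<close>
      by (intro exI[of _ "y # vs"]) auto
  qed
qed

text \<open>Otherwise every side between \<open>a\<close> and \<open>b\<close> would be covered by an edge strictly below \<open>{a, b}\<close>, and
  the walk from \<open>a\<close> to \<open>b\<close> just constructed would close up with \<open>{a, b}\<close> to a cycle.\<close>

lemma innermost_side_exists:
  assumes "{a, b} \<in> E" "a < b"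
  shows "\<exists>i. innermost_edge E i a b"
proof (rule ccontr)
  assume none: "\<not> ?thesis"
  have cover: "\<exists>c d. {c, d} \<in> E \<and> separates_edge a b c d \<and> c < i \<and> i \<le> d"
    if i: "a < i" "i \<le> b" for i
  proof -
    obtain c d where cd: "innermost_edge E i c d"
      using innermost_edge_exists[of i] edge_bound[OF assms] i by auto
    moreover from this have "a \<le> c" "d \<le> b" using i assms by (auto simp: innermost_edge_def)
    moreover have "(c, d) \<noteq> (a, b)" using none cd by auto
    ultimately show ?thesis unfolding innermost_edge_def separates_edge_def by fastforce
  qed
  obtain vs where vs: "sorted_wrt (<) (a # vs)" "vs \<noteq> []" "last vs = b"
    "successively (\<lambda>c d. {c, d} \<in> E \<and> separates_edge a b c d) (a # vs)"
    using path_from_uncovered_vertex[of a b a] cover assms by (auto simp: separates_edge_def)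
  \<comment> \<open>A single step from \<open>a\<close> to \<open>b\<close> would be the edge \<open>{a, b}\<close> itself, which is not strictly below itself.\<close>
  have "length vs \<noteq> 1"
    using vs by (auto simp: length_Suc_conv separates_edge_def)
  then have "3 \<le> length (a # vs)" using vs(2) by (cases vs) (auto simp: Suc_le_eq)
  moreover have "distinct (a # vs)" using vs(1) strict_sorted_iff by blast
  moreover have "{(a # vs) ! i, (a # vs) ! (Suc i mod length (a # vs))} \<in> E" if "i < length (a # vs)" for i
  proof (cases "i = length vs")
    case True
    then have "{(a # vs) ! i, (a # vs) ! (Suc i mod length (a # vs))} = {a, b}"
      using vs(2,3) by (auto simp: last_conv_nth nth_Cons')
    then show ?thesis using assms by simp
  next
    case False
    then show ?thesis using that vs(4) by (auto simp: successively_conv_nth)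
  qed
  ultimately have "graph_cycle E (a # vs)" by (simp add: graph_cycle_def)
  then show False using no_cycle by blast
qed

lemma innermost_edge_label:
  assumes "{a, b} \<in> E" "a < b"
  shows "innermost_edge E (edge_label E a b) a b"
proof -
  obtain i where i: "innermost_edge E i a b" using innermost_side_exists[OF assms] by blast
  have "edge_label E a b = i"
  proof (cases "b = a + 1")
    case True
    then show ?thesis using i by (auto simp: edge_label_def innermost_edge_def)
  next
    case False
    let ?Q = "\<lambda>j. separates_side a b j \<and> {j - 1, j} \<notin> E \<and>
       (\<forall>c d. {c, d} \<in> E \<and> separates_edge a b c d \<longrightarrow> \<not> separates_side c d j)"
    have bounds: "a < i" "i \<le> b" and min: "\<And>c d. {c, d} \<in> E \<Longrightarrow> c < i \<Longrightarrow> i \<le> d \<Longrightarrow> c \<le> a \<and> b \<le> d"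
      using i by (auto simp: innermost_edge_def)
    have "?Q i"
    proof (intro conjI allI impI)
      show "separates_side a b i" using bounds by (simp add: separates_side_def)
      show "{i - 1, i} \<notin> E" using min[of "i - 1" i] bounds False by auto
      show "\<not> separates_side c d i" if "{c, d} \<in> E \<and> separates_edge a b c d" for c d
        using min[of c d] that by (auto simp: separates_edge_def separates_side_def)
    qed
    moreover have "j = i" if j: "?Q j" for j
    proof -
      have "a < j" "j \<le> b" using j by (auto simp: separates_side_def)
      then obtain c d where cd: "innermost_edge E j c d"
        using innermost_edge_exists[of j] edge_bound[OF assms] by auto
      then have "a \<le> c" "d \<le> b" "c < j" "j \<le> d" "{c, d} \<in> E"
        using assms \<open>a < j\<close> \<open>j \<le> b\<close> by (auto simp: innermost_edge_def)
      moreover have "separates_side c d j" using \<open>c < j\<close> \<open>j \<le> d\<close> by (simp add: separates_side_def)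
      ultimately have "\<not> separates_edge a b c d" using j by blast
      then have "(c, d) = (a, b)"
        using \<open>a \<le> c\<close> \<open>d \<le> b\<close> \<open>c < j\<close> \<open>j \<le> d\<close> by (auto simp: separates_edge_def)
      then show ?thesis using cd i innermost_side_unique by auto
    qed
    ultimately have "(THE j. ?Q j) = i" by (rule the_equality)
    then show ?thesis using False by (simp add: edge_label_def)
  qed
  then show ?thesis using i by simp
qed

lemma edge_label_eq_iff: "a < b \<Longrightarrow> {a, b} \<in> E \<Longrightarrow> edge_label E a b = i \<longleftrightarrow> innermost_edge E i a b"
  using innermost_edge_label innermost_side_unique by blast

text \<open>By the correspondence between sides and innermost edges, the label \<open>i\<close> is below \<open>j\<close> iff the
  innermost edge of \<open>i\<close> lies strictly inside that of \<open>j\<close>; by innermostness, this only requires the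
  innermost edge of \<open>j\<close> to pass over side \<open>i\<close>.\<close>

lemma nct_poset_iff:
  assumes "innermost_edge E j a b"
  shows "(i, j) \<in> nct_poset E \<longleftrightarrow> i \<noteq> j \<and> a < i \<and> i \<le> b"
proof
  assume "(i, j) \<in> nct_poset E"
  then obtain a' b' c d where e: "{a', b'} \<in> E" "{c, d} \<in> E" "a' < b'" "separates_edge a' b' c d"
    "i = edge_label E c d" "j = edge_label E a' b'"
    unfolding nct_poset_def by auto
  have i: "innermost_edge E i c d" and "innermost_edge E j a' b'"
    using e innermost_edge_label by (auto simp: separates_edge_def)
  then have "a' = a" "b' = b" using assms innermost_edge_unique by blast+
  moreover have "c < i" "i \<le> d" using i unfolding innermost_edge_def by blast+
  ultimately have "a < i" "i \<le> b" "(c, d) \<noteq> (a, b)" using e(4) by (auto simp: separates_edge_def)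
  then show "i \<noteq> j \<and> a < i \<and> i \<le> b"
    using i assms innermost_edge_unique by blast
next
  assume i: "i \<noteq> j \<and> a < i \<and> i \<le> b"
  have ab: "{a, b} \<in> E" "a < b" using assms by (auto simp: innermost_edge_def)
  obtain c d where cd: "innermost_edge E i c d"
    using innermost_edge_exists[of i] edge_bound[OF ab] i by auto
  have "(c, d) \<noteq> (a, b)" using innermost_side_unique[of i a b j] cd assms i by auto
  moreover have "a \<le> c" "d \<le> b" "c < d" "{c, d} \<in> E"
    using cd ab i by (auto simp: innermost_edge_def)
  moreover have "edge_label E c d = i" "edge_label E a b = j"
    using cd assms edge_label_eq_iff by (auto simp: innermost_edge_def)
  ultimately have "i = edge_label E c d \<and> j = edge_label E a b \<and> {a, b} \<in> E \<and> {c, d} \<in> E \<and>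
      a < b \<and> separates_edge a b c d"
    using ab by (auto simp: separates_edge_def)
  then show "(i, j) \<in> nct_poset E"
    unfolding nct_poset_def by blast
qed

end

section \<open>The Tamari interval of a non-crossing tree\<close>

text \<open>The bounds \<open>hi\<close> and \<open>lo\<close> are themselves the reaches of trees \<open>t\<^sub>0\<close> (to the right) and \<open>t\<^sub>1\<close> (to
  the left), because the intervals \<open>{lo j..hi j}\<close> are nested. By the two descriptions of the Tamari
  order, the trees in question are those above \<open>t\<^sub>0\<close> and below \<open>t\<^sub>1\<close>. That \<open>t\<^sub>0\<close> is below \<open>t\<^sub>1\<close> comes
  from antisymmetry: for \<open>j < k \<le> hi j\<close> the interval of \<open>k\<close> cannot contain \<open>j\<close>, so that in \<open>t\<^sub>1\<close>
  the subtree of \<open>k\<close> starts after \<open>j\<close>.\<close>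

lemma bounded_trees_tamari_interval:
  fixes lo hi :: "nat \<Rightarrow> nat"
  assumes bounds: "\<And>j. j < n \<Longrightarrow> lo j \<le> j \<and> j \<le> hi j \<and> hi j < n"
    and nested: "\<And>j k. j < n \<Longrightarrow> lo j \<le> k \<Longrightarrow> k \<le> hi j \<Longrightarrow> lo j \<le> lo k \<and> hi k \<le> hi j"
    and antisym: "\<And>j k. j < n \<Longrightarrow> k < n \<Longrightarrow> lo j \<le> k \<Longrightarrow> k \<le> hi j \<Longrightarrow> lo k \<le> j \<Longrightarrow> j \<le> hi k \<Longrightarrow> j = k"
  shows "tamari_interval n
    {t. size t = n \<and> (\<forall>j<n. hi j \<le> j + right_sizes t ! j \<and> j \<le> lo j + left_sizes t ! j)}"
proof -
  let ?r = "map (\<lambda>j. hi j - j) [0..<n]" and ?l = "map (\<lambda>j. j - lo j) [0..<n]"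
  have "\<exists>t :: pbtree. right_sizes t = ?r"
  proof (rule tree_with_right_sizes)
    show "j + ?r ! j < length ?r" if "j < length ?r" for j
      using that bounds[of j] by simp
    show "k + ?r ! k \<le> j + ?r ! j" if "j \<le> k" "k \<le> j + ?r ! j" "j < length ?r" for j k
      using that bounds[of j] bounds[of k] nested[of j k] by simp
  qed
  then obtain t\<^sub>0 :: pbtree where t\<^sub>0: "right_sizes t\<^sub>0 = ?r" by blast
  have "\<exists>t :: pbtree. left_sizes t = ?l"
  proof (rule tree_with_left_sizes)
    show "?l ! j \<le> j" if "j < length ?l" for j using that by simp
    show "j + ?l ! k \<le> k + ?l ! j" if "k \<le> j" "j \<le> k + ?l ! j" "j < length ?l" for j k
    proof -
      have "lo j \<le> j" "j \<le> hi j" "j \<le> k + (j - lo j)" "lo k \<le> k"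
        using that bounds[of j] bounds[of k] by simp_all
      then have "lo j \<le> k" "lo j \<le> lo k" using nested[of j k] that by auto
      then have "j + (k - lo k) \<le> k + (j - lo j)" using \<open>lo j \<le> j\<close> \<open>lo k \<le> k\<close> by linarith
      then show ?thesis using that by simp
    qed
  qed
  then obtain t\<^sub>1 :: pbtree where t\<^sub>1: "left_sizes t\<^sub>1 = ?l" by blast
  have size: "size t\<^sub>0 = n" "size t\<^sub>1 = n"
    using arg_cong[OF t\<^sub>0, of length] arg_cong[OF t\<^sub>1, of length] by simp_all
  have above: "tamari_le t\<^sub>0 t \<longleftrightarrow> (\<forall>j<n. hi j \<le> j + right_sizes t ! j)" if "size t = n" for t
    using that by (auto simp: tamari_le_iff_right_sizes t\<^sub>0 list_all2_conv_all_nth le_diff_conv)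
  have below: "tamari_le t t\<^sub>1 \<longleftrightarrow> (\<forall>j<n. j \<le> lo j + left_sizes t ! j)" if "size t = n" for t
    using that by (auto simp: tamari_le_iff_left_sizes t\<^sub>1 list_all2_conv_all_nth le_diff_conv)
  have "hi j \<le> j + right_sizes t\<^sub>1 ! j" if j: "j < n" for j
  proof -
    have "j < lo k" if "j < k" "k \<le> hi j" for k
      using antisym[of j k] nested[of j k] bounds[of j] bounds[of k] that j
      by (cases "lo k \<le> j") auto
    then have "j + left_sizes t\<^sub>1 ! k < k" if "j < k" "k \<le> hi j" for k
      using bounds[OF j] that by (fastforce simp: t\<^sub>1)
    then have "hi j - j \<le> right_sizes t\<^sub>1 ! j"
      using right_sizes_iff_left_sizes[of j "hi j - j" t\<^sub>1] bounds[OF j] by (simp add: size)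
    then show ?thesis by simp
  qed
  then have "tamari_le t\<^sub>0 t\<^sub>1" using above size by blast
  moreover have "{t. size t = n \<and> (\<forall>j<n. hi j \<le> j + right_sizes t ! j \<and> j \<le> lo j + left_sizes t ! j)}
      = {t. size t = n \<and> tamari_le t\<^sub>0 t \<and> tamari_le t t\<^sub>1}"
    using above below by blast
  ultimately show ?thesis using size unfolding tamari_interval_def by blast
qed

text \<open>Being to the left in the word of a permutation means having a smaller letter in the word of its
  inverse. Positions are counted from 0 and elements of the poset from 1, hence the shift.\<close>

lemma mem_linear_extensions_iff:
  "\<sigma> \<in> linear_extensions n P \<longleftrightarrow> perm_size \<sigma> = n \<and>
     (\<forall>i<n. \<forall>j<n. (Suc i, Suc j) \<in> P \<longrightarrow> inv_word \<sigma> ! i < inv_word \<sigma> ! j)"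
proof (cases "perm_size \<sigma> = n")
  case True
  let ?f = "perm_fun \<sigma>"
  have f: "?f permutes {1..n}" using perm_fun_permutes[of \<sigma>] True by simp
  have inv: "\<And>i. i < n \<Longrightarrow> inv_word \<sigma> ! i = inv ?f (Suc i)" using True by (simp add: nth_inv_word)
  have "(\<forall>p\<in>{1..n}. \<forall>q\<in>{1..n}. (?f p, ?f q) \<in> P \<longrightarrow> p < q)
    \<longleftrightarrow> (\<forall>x\<in>{1..n}. \<forall>y\<in>{1..n}. (x, y) \<in> P \<longrightarrow> inv ?f x < inv ?f y)" (is "?A \<longleftrightarrow> ?B")
  proof
    assume A: ?A
    show ?B
    proof (intro ballI impI)
      fix x y assume xy: "x \<in> {1..n}" "y \<in> {1..n}" "(x, y) \<in> P"
      then have "inv ?f x \<in> {1..n}" "inv ?f y \<in> {1..n}"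
        using permutes_in_image[OF permutes_inv[OF f]] by blast+
      then show "inv ?f x < inv ?f y"
        using A xy(3) by (simp add: permutes_inverses[OF f])
    qed
  next
    assume B: ?B
    show ?A
    proof (intro ballI impI)
      fix p q assume pq: "p \<in> {1..n}" "q \<in> {1..n}" "(?f p, ?f q) \<in> P"
      then have "?f p \<in> {1..n}" "?f q \<in> {1..n}"
        using permutes_in_image[OF f] by blast+
      then have "inv ?f (?f p) < inv ?f (?f q)" using B pq(3) by blast
      then show "p < q" by (simp add: permutes_inverses[OF f])
    qed
  qed
  also have "?B \<longleftrightarrow> (\<forall>i<n. \<forall>j<n. (Suc i, Suc j) \<in> P \<longrightarrow> inv_word \<sigma> ! i < inv_word \<sigma> ! j)"
    unfolding image_Suc_lessThan[symmetric] by (auto simp: inv)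
  finally show ?thesis using True by (simp add: linear_extensions_def)
qed (simp add: linear_extensions_def)

text \<open>When each principal ideal of \<open>P\<close> is an interval of positions, a linear extension is a word in
  which each letter is the maximum over its interval; in the decreasing tree this means that each
  interval is contained in the range of the subtree of its node.\<close>

lemma linear_extensions_iff_perm_shape:
  fixes lo hi :: "nat \<Rightarrow> nat"
  assumes bounds: "\<And>j. j < n \<Longrightarrow> lo j \<le> j \<and> j \<le> hi j \<and> hi j < n"
    and P: "\<And>i j. i < n \<Longrightarrow> j < n \<Longrightarrow> (Suc i, Suc j) \<in> P \<longleftrightarrow> i \<noteq> j \<and> lo j \<le> i \<and> i \<le> hi j"
  shows "\<sigma> \<in> linear_extensions n P \<longleftrightarrow> perm_size \<sigma> = n \<and>
    (\<forall>j<n. hi j \<le> j + right_sizes (perm_shape \<sigma>) ! j \<and> j \<le> lo j + left_sizes (perm_shape \<sigma>) ! j)"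
proof (cases "perm_size \<sigma> = n")
  case True
  let ?w = "inv_word \<sigma>"
  have right: "hi j \<le> j + right_sizes (perm_shape \<sigma>) ! j \<longleftrightarrow> (\<forall>i. j < i \<and> i \<le> hi j \<longrightarrow> ?w ! i < ?w ! j)"
    if "j < n" for j
    using right_sizes_decreasing_tree[of ?w j "hi j - j"] bounds[OF that] True
    by (simp add: perm_shape_def le_diff_conv add.commute)
  have left: "j \<le> lo j + left_sizes (perm_shape \<sigma>) ! j \<longleftrightarrow> (\<forall>i. lo j \<le> i \<and> i < j \<longrightarrow> ?w ! i < ?w ! j)"
    if "j < n" for j
  proof -
    have "j \<le> i + (j - lo j) \<longleftrightarrow> lo j \<le> i" for i using bounds[OF that] by auto
    then show ?thesis
      using left_sizes_decreasing_tree[of ?w "j - lo j" j] that True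
      by (simp add: perm_shape_def le_diff_conv add.commute)
  qed
  have below: "(\<forall>i<n. (Suc i, Suc j) \<in> P \<longrightarrow> ?w ! i < ?w ! j) \<longleftrightarrow>
      (\<forall>i. j < i \<and> i \<le> hi j \<longrightarrow> ?w ! i < ?w ! j) \<and> (\<forall>i. lo j \<le> i \<and> i < j \<longrightarrow> ?w ! i < ?w ! j)"
    (is "?A \<longleftrightarrow> ?B") if "j < n" for j
  proof -
    have "?A \<longleftrightarrow> (\<forall>i. i \<noteq> j \<and> lo j \<le> i \<and> i \<le> hi j \<longrightarrow> ?w ! i < ?w ! j)"
      using P that bounds[OF that] by (auto dest: le_less_trans)
    also have "\<dots> \<longleftrightarrow> ?B"
    proof -
      have "i \<noteq> j \<and> lo j \<le> i \<and> i \<le> hi j \<longleftrightarrow> j < i \<and> i \<le> hi j \<or> lo j \<le> i \<and> i < j" for i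
        using bounds[OF that] by auto
      then show ?thesis by blast
    qed
    finally show ?thesis .
  qed
  have "(\<forall>i<n. \<forall>j<n. (Suc i, Suc j) \<in> P \<longrightarrow> ?w ! i < ?w ! j)
      \<longleftrightarrow> (\<forall>j<n. \<forall>i<n. (Suc i, Suc j) \<in> P \<longrightarrow> ?w ! i < ?w ! j)" by blast
  also have "\<dots> \<longleftrightarrow> (\<forall>j<n. hi j \<le> j + right_sizes (perm_shape \<sigma>) ! j \<and> j \<le> lo j + left_sizes (perm_shape \<sigma>) ! j)"
    by (intro iff_allI imp_cong refl) (simp only: below left right)
  finally show ?thesis using True by (simp only: mem_linear_extensions_iff simp_thms)
qed (simp add: linear_extensions_def)

theorem theorem5p4:
  fixes n :: nat and T :: "nat set set"
  assumes "n \<ge> 1" and "noncrossing_tree n T"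
  shows "(\<exists>!I. I \<subseteq> {t. size t = n} \<and>
            (\<Sum>\<sigma>\<in>linear_extensions n (nct_poset T). F_basis \<sigma> :: 'k::field fqsym) = (\<Sum>t\<in>I. P_basis t)) \<and>
         (\<forall>I. I \<subseteq> {t. size t = n} \<and>
            (\<Sum>\<sigma>\<in>linear_extensions n (nct_poset T). F_basis \<sigma> :: 'k::field fqsym) = (\<Sum>t\<in>I. P_basis t)
            \<longrightarrow> tamari_interval n I)"
proof -
  interpret nc_tree n T by unfold_locales (rule assms(2))
  \<comment> \<open>Node \<open>j\<close> of a tree stands for side \<open>j + 1\<close>; if its innermost edge is \<open>{a, b}\<close>, the nodes for the
    sides \<open>a + 1, ..., b\<close> below it are \<open>a, ..., b - 1\<close>. So its interval is \<open>{a..h}\<close> with \<open>b = h + 1\<close>.\<close>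
  have "\<exists>a h. j < n \<longrightarrow> innermost_edge T (Suc j) a (Suc h)" for j
  proof (cases "j < n")
    case True
    then obtain a b where ab: "innermost_edge T (Suc j) a b"
      using innermost_edge_exists[of "Suc j"] by auto
    then obtain h where "b = Suc h" by (cases b) (auto simp: innermost_edge_def)
    then show ?thesis using ab by blast
  qed simp
  then obtain lo hi where innermost: "\<And>j. j < n \<Longrightarrow> innermost_edge T (Suc j) (lo j) (Suc (hi j))"
    by metis
  have bounds: "lo j \<le> j \<and> j \<le> hi j \<and> hi j < n" if "j < n" for j
    using innermost[OF that] edge_bound[of "lo j" "Suc (hi j)"] by (auto simp: innermost_edge_def)
  have nested: "lo j \<le> lo k \<and> hi k \<le> hi j" if "j < n" "lo j \<le> k" "k \<le> hi j" for j k
  proof -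
    have "k < n" using that bounds[of j] by simp
    have "{lo j, Suc (hi j)} \<in> T" "lo j < Suc k" "Suc k \<le> Suc (hi j)"
      using innermost[OF \<open>j < n\<close>] that by (auto simp: innermost_edge_def)
    then have "lo j \<le> lo k \<and> Suc (hi k) \<le> Suc (hi j)"
      using innermost[OF \<open>k < n\<close>] unfolding innermost_edge_def by blast
    then show ?thesis by simp
  qed
  have antisym: "j = k"
    if "j < n" "k < n" "lo j \<le> k" "k \<le> hi j" "lo k \<le> j" "j \<le> hi k" for j k
  proof -
    have "lo j = lo k" "hi j = hi k" using nested[of j k] nested[of k j] that by auto
    then have "Suc j = Suc k"
      using innermost[of j] innermost[of k] that innermost_side_unique by metis
    then show ?thesis by simp
  qed
  have P: "(Suc i, Suc j) \<in> nct_poset T \<longleftrightarrow> i \<noteq> j \<and> lo j \<le> i \<and> i \<le> hi j" if "i < n" "j < n" for i j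
    unfolding nct_poset_iff[OF innermost[OF that(2)]] by (simp add: less_Suc_eq_le)
  define J :: "pbtree set" where
    "J = {t. size t = n \<and> (\<forall>j<n. hi j \<le> j + right_sizes t ! j \<and> j \<le> lo j + left_sizes t ! j)}"
  have "\<sigma> \<in> linear_extensions n (nct_poset T) \<longleftrightarrow> perm_size \<sigma> = n \<and> perm_shape \<sigma> \<in> J" for \<sigma>
    using linear_extensions_iff_perm_shape[of n lo hi "nct_poset T" \<sigma>, OF bounds P] by (auto simp: J_def)
  then have "linear_extensions n (nct_poset T) = {\<sigma>. perm_size \<sigma> = n \<and> perm_shape \<sigma> \<in> J}"
    by blast
  then have eq_iff: "(\<Sum>\<sigma>\<in>linear_extensions n (nct_poset T). F_basis \<sigma> :: 'k fqsym) = (\<Sum>t\<in>I. P_basis t)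
      \<longleftrightarrow> I = J" if "I \<subseteq> {t. size t = n}" for I
    using that by (intro sum_F_basis_eq_sum_P_basis_iff) (auto simp: J_def)
  have "J \<subseteq> {t. size t = n}" by (auto simp: J_def)
  then have solution: "I \<subseteq> {t. size t = n} \<and>
      (\<Sum>\<sigma>\<in>linear_extensions n (nct_poset T). F_basis \<sigma> :: 'k fqsym) = (\<Sum>t\<in>I. P_basis t)
      \<longleftrightarrow> I = J" for I
    using eq_iff[of I] by blast
  have "tamari_interval n J"
    unfolding J_def using bounds nested antisym by (rule bounded_trees_tamari_interval)
  then show ?thesis unfolding solution by simp
qed

end
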